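(* Let $a<b$ be real numbers, $D^+=[a,b]$, $D\subseteq D^+$, $n\ge1$, $\alpha\in(0,1)$, and let $\boldsymbol{\ell}\in[0,1]^n$ be such that $G_{\mathbf{X},\boldsymbol{\ell}}$ is an exact $(1-\alpha)$ lower confidence bound for the CDF. Let $i_0=\arg\min_{i:\,\ell_{(i)}>0}\ell_{(i)}$ (the smallest index $i$ with $\ell_{(i)}>0$). Let $T(\mathbf{y})=m_{D^+}(\mathbf{y},\boldsymbol{\ell})$. Then for every $\mathbf{x}\in D^n$: $$b^{\alpha}_{D^+,T}(\mathbf{x})=m_{D^+}(\mathbf{x},\boldsymbol{\ell})\quad\text{if } a\le b-\frac{b-m_{D^+}(\mathbf{x},\boldsymbol{\ell})}{\ell_{(i_0)}},$$ $$b^{\alpha}_{D^+,T}(\mathbf{x})<m_{D^+}(\mathbf{x},\boldsymbol{\ell})\quad\text{if } a> b-\frac{b-m_{D^+}(\mathbf{x},\boldsymbol{\ell})}{\ell_{(i_0)}}\ \text{ and } n>i_0 .$$ In particular, if $x_i<b-\frac{(b-a)\ell_{(i_0)}}{\ell_{(n)}}$ for all $1\le i\le n$ and $n>i_0$, then $b^{\alpha}_{D^+,T}(\mathbf{x})<m_{D^+}(\mathbf{x},\boldsymbol{\ell})$.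
   Context: For a vector $\mathbf{v}\in\mathbb{R}^n$ let $v_{(1)}\le\dots\le v_{(n)}$ denote its sorted entries. Let $E\subset\mathbb{R}$ with $s_E=\sup E<\infty$ (here $E=D^+$). For $\mathbf{x}\in E^n$ and $\boldsymbol{\ell}\in[0,1]^n$, with the conventions $\ell_{(0)}=0$, $\ell_{(n+1)}=1$, $x_{(n+1)}=s_E$, put $$m_E(\mathbf{x},\boldsymbol{\ell})=\sum_{i=1}^{n+1}x_{(i)}(\ell_{(i)}-\ell_{(i-1)})=s_E-\sum_{i=1}^n \ell_{(i)}(x_{(i+1)}-x_{(i)}).$$ $G_{\mathbf{x},\boldsymbol{\ell}}:\mathbb{R}\to[0,1]$ is the step function equal to $0$ for $x<x_{(1)}$, to $\ell_{(i)}$ for $x_{(i)}\le x<x_{(i+1)}$ ($1\le i\le n$), and to $1$ for $x\ge s_E$. For $T:E^n\to\mathbb{R}$ and $\mathbf{x}\in E^n$ let $\mathbb{S}_{E,T}(\mathbf{x})=\{\mathbf{y}\in E^n:T(\mathbf{y})\le T(\mathbf{x})\}$ and $b_{E,T}(\mathbf{x},\mathbf{u})=\sup_{\mathbf{z}\in\mathbb{S}_{E,T}(\mathbf{x})}m_E(\mathbf{z},\mathbf{u})$ for $\mathbf{u}\in[0,1]^n$. Let $\mathbf{U}$ have $n$ i.i.d. uniform$[0,1]$ entries. With $Q(p,Y)=\inf\{y\in\mathbb{R}:F_Y(y)\ge p\}$ the quantile function of a random variable $Y$ with CDF $F_Y$, define $b^{\alpha}_{E,T}(\mathbf{x})=Q(1-\alpha,b_{E,T}(\mathbf{x},\mathbf{U}))$.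 Lower confidence bound: a function $H_{\mathbf{X}}:\mathbb{R}\to[0,1]$ computed from an i.i.d. sample $\mathbf{X}=(X_1,\dots,X_n)$ is a $(1-\alpha)$ lower confidence bound for the CDF if for every CDF $F$ of a distribution on $D^+$, when $\mathbf{X}$ is sampled from $F$, $\mathbb{P}_{\mathbf{X}}(\forall x\in\mathbb{R},\ F(x)\ge H_{\mathbf{X}}(x))\ge 1-\alpha$. It is exact if in addition there exists such an $F$ for which this probability equals $1-\alpha$. *)

theory Defs
  imports "HOL-Probability.Probability"
begin

text \<open>
  A vector of \<open>\<real>\<^sup>n\<close> is a function on the index set \<open>{1..n}\<close>, extensional outside of it, so
  that \<open>space (Pi\<^sub>M {1..n} M)\<close> consists of such vectors.
\<close>

abbreviation vecs :: "nat \<Rightarrow> real set \<Rightarrow> (nat \<Rightarrow> real) set" where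
  "vecs n E \<equiv> {1..n} \<rightarrow>\<^sub>E E"

text \<open>The \<open>i\<close>-th smallest entry \<open>v\<^sub>(\<^sub>i\<^sub>)\<close>, meaningful for \<open>1 \<le> i \<le> n\<close>; list indices start at 0.\<close>

definition sorted_entry :: "nat \<Rightarrow> (nat \<Rightarrow> real) \<Rightarrow> nat \<Rightarrow> real" where
  "sorted_entry n v i = sort (map v [1..<Suc n]) ! (i - 1)"

text \<open>Boundary conventions \<open>x\<^sub>(\<^sub>n\<^sub>+\<^sub>1\<^sub>) = sup E\<close>, \<open>\<ell>\<^sub>(\<^sub>0\<^sub>) = 0\<close> and \<open>\<ell>\<^sub>(\<^sub>n\<^sub>+\<^sub>1\<^sub>) = 1\<close>.\<close>

definition sample_entry :: "real set \<Rightarrow> nat \<Rightarrow> (nat \<Rightarrow> real) \<Rightarrow> nat \<Rightarrow> real" where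
  "sample_entry E n x i = (if i = n + 1 then Sup E else sorted_entry n x i)"

definition level_entry :: "nat \<Rightarrow> (nat \<Rightarrow> real) \<Rightarrow> nat \<Rightarrow> real" where
  "level_entry n l i =
    (if i = 0 then 0 else if i = n + 1 then 1 else sorted_entry n l i)"

definition induced_mean :: "real set \<Rightarrow> nat \<Rightarrow> (nat \<Rightarrow> real) \<Rightarrow> (nat \<Rightarrow> real) \<Rightarrow> real" where
  "induced_mean E n x l =
    (\<Sum>i=1..n+1. sample_entry E n x i * (level_entry n l i - level_entry n l (i - 1)))"

lemma induced_mean_alt:
  "induced_mean E n x l =
    Sup E - (\<Sum>i=1..n. level_entry n l i * (sample_entry E n x (i + 1) - sample_entry E n x i))"
proof -
  have "(\<Sum>i=1..m+1. f i * (g i - g (i - 1))) =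
      f (m + 1) * g (m + 1) - f 1 * g 0 - (\<Sum>i=1..m. g i * (f (i + 1) - f i))"
    for f g :: "nat \<Rightarrow> real" and m
    by (induction m) (simp_all add: algebra_simps)
  from this[of "sample_entry E n x" "level_entry n l" n] show ?thesis
    by (simp add: induced_mean_def sample_entry_def level_entry_def)
qed

text \<open>
  The step function with value \<open>0\<close> left of \<open>x\<^sub>(\<^sub>1\<^sub>)\<close>, \<open>\<ell>\<^sub>(\<^sub>i\<^sub>)\<close> on \<open>[x\<^sub>(\<^sub>i\<^sub>), x\<^sub>(\<^sub>i\<^sub>+\<^sub>1\<^sub>))\<close> and \<open>1\<close> from
  \<open>sup E\<close> on. For \<open>x \<in> vecs n E\<close> with \<open>E\<close> bounded above these intervals are pairwise disjoint
  (and empty where entries are tied).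
\<close>

definition step_bound ::
    "real set \<Rightarrow> nat \<Rightarrow> (nat \<Rightarrow> real) \<Rightarrow> (nat \<Rightarrow> real) \<Rightarrow> real \<Rightarrow> real" where
  "step_bound E n x l t =
    (\<Sum>i=1..n. level_entry n l i *
       indicator {sample_entry E n x i ..< sample_entry E n x (i + 1)} t)
    + indicator {Sup E ..} t"

lemma sample_entry_mono:
  assumes "x \<in> vecs n E" "bdd_above E" "1 \<le> i" "i \<le> j" "j \<le> n + 1"
  shows "sample_entry E n x i \<le> sample_entry E n x j"
proof (cases "j = n + 1")
  case False
  with assms show ?thesis
    unfolding sample_entry_def sorted_entry_def
    by (auto simp del: upt_Suc intro!: sorted_nth_mono)
next
  case j: True
  show ?thesis
  proof (cases "i = n + 1")
    case False
    have "sort (map x [1..<Suc n]) ! (i - 1) \<in> set (sort (map x [1..<Suc n]))"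
      using assms False by (intro nth_mem) (auto simp del: upt_Suc)
    then have "sorted_entry n x i \<in> x ` {1..n}"
      unfolding sorted_entry_def by (simp del: upt_Suc add: atLeastLessThanSuc_atLeastAtMost)
    with assms(1) have "sorted_entry n x i \<in> E" by (auto simp: PiE_iff)
    with assms(2) j False show ?thesis by (simp add: sample_entry_def cSup_upper)
  qed (use j in simp)
qed

lemma step_bound_eq:
  assumes "x \<in> vecs n E" "bdd_above E"
  shows "n \<ge> 1 \<Longrightarrow> t < sorted_entry n x 1 \<Longrightarrow> step_bound E n x l t = 0"
    and "i \<in> {1..n} \<Longrightarrow> sample_entry E n x i \<le> t \<Longrightarrow> t < sample_entry E n x (i + 1) \<Longrightarrow>
      step_bound E n x l t = sorted_entry n l i"
    and "Sup E \<le> t \<Longrightarrow> step_bound E n x l t = 1"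
proof -
  note mono = sample_entry_mono[OF assms]
  have top: "sample_entry E n x j \<le> Sup E" if "j \<in> {1..n+1}" for j
    using mono[of j "n + 1"] that by (simp add: sample_entry_def)
  show "step_bound E n x l t = 0" if n: "n \<ge> 1" and t: "t < sorted_entry n x 1"
  proof -
    have *: "t < sample_entry E n x j" if "j \<in> {1..n+1}" for j
      using mono[of 1 j] that t n by (simp add: sample_entry_def split: if_splits)
    have "t < Sup E" using *[of "n + 1"] by (simp add: sample_entry_def)
    moreover have "\<not> sample_entry E n x j \<le> t" if "j \<in> {1..n}" for j
      using *[of j] that by auto
    ultimately show ?thesis
      unfolding step_bound_def by (simp add: indicator_def)
  qed
  show "step_bound E n x l t = sorted_entry n l i"
    if i: "i \<in> {1..n}" and t: "sample_entry E n x i \<le> t" "t < sample_entry E n x (i + 1)"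
  proof -
    have "\<not> (sample_entry E n x j \<le> t \<and> t < sample_entry E n x (j + 1))"
      if "j \<in> {1..n}" "j \<noteq> i" for j
      using mono[of "j + 1" i] mono[of "i + 1" j] that i t by (cases "j < i") auto
    then have "(\<Sum>j=1..n. level_entry n l j *
        indicator {sample_entry E n x j ..< sample_entry E n x (j + 1)} t) =
        (\<Sum>j=1..n. if j = i then level_entry n l j else 0)"
      using t by (intro sum.cong) (auto simp: indicator_def)
    also have "\<dots> = sorted_entry n l i"
      using i by (simp add: level_entry_def)
    finally show ?thesis
      using top[of "i + 1"] i t by (simp add: step_bound_def)
  qed
  show "step_bound E n x l t = 1" if t: "Sup E \<le> t"
  proof -
    have "\<not> t < sample_entry E n x (j + 1)" if "j \<in> {1..n}" for j
      using top[of "j + 1"] that t by auto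
    with t show ?thesis unfolding step_bound_def by (simp add: indicator_def)
  qed
qed

definition distribution_on :: "real set \<Rightarrow> real measure \<Rightarrow> bool" where
  "distribution_on E M \<longleftrightarrow> real_distribution M \<and> (AE t in M. t \<in> E)"

definition coverage ::
    "nat \<Rightarrow> ((nat \<Rightarrow> real) \<Rightarrow> real \<Rightarrow> real) \<Rightarrow> real measure \<Rightarrow> real" where
  "coverage n H M =
    measure (Pi\<^sub>M {1..n} (\<lambda>_. M))
      {X \<in> space (Pi\<^sub>M {1..n} (\<lambda>_. M)). \<forall>t. cdf M t \<ge> H X t}"

definition lower_confidence_bound ::
    "real set \<Rightarrow> nat \<Rightarrow> real \<Rightarrow> ((nat \<Rightarrow> real) \<Rightarrow> real \<Rightarrow> real) \<Rightarrow> bool" where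
  "lower_confidence_bound E n \<alpha> H \<longleftrightarrow>
    (\<forall>X \<in> vecs n E. \<forall>t. H X t \<in> {0..1}) \<and>
    (\<forall>M. distribution_on E M \<longrightarrow> coverage n H M \<ge> 1 - \<alpha>)"

definition exact_lower_confidence_bound ::
    "real set \<Rightarrow> nat \<Rightarrow> real \<Rightarrow> ((nat \<Rightarrow> real) \<Rightarrow> real \<Rightarrow> real) \<Rightarrow> bool" where
  "exact_lower_confidence_bound E n \<alpha> H \<longleftrightarrow>
    lower_confidence_bound E n \<alpha> H \<and>
    (\<exists>M. distribution_on E M \<and> coverage n H M = 1 - \<alpha>)"

definition sublevel_set ::
    "real set \<Rightarrow> nat \<Rightarrow> ((nat \<Rightarrow> real) \<Rightarrow> real) \<Rightarrow> (nat \<Rightarrow> real) \<Rightarrow> (nat \<Rightarrow> real) set" where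
  "sublevel_set E n T x = {y \<in> vecs n E. T y \<le> T x}"

definition sup_mean ::
    "real set \<Rightarrow> nat \<Rightarrow> ((nat \<Rightarrow> real) \<Rightarrow> real) \<Rightarrow> (nat \<Rightarrow> real) \<Rightarrow> (nat \<Rightarrow> real) \<Rightarrow> real" where
  "sup_mean E n T x u = (SUP z \<in> sublevel_set E n T x. induced_mean E n z u)"

definition quantile :: "'a measure \<Rightarrow> real \<Rightarrow> ('a \<Rightarrow> real) \<Rightarrow> real" where
  "quantile P p Y = Inf {y. cdf (distr P borel Y) y \<ge> p}"

definition upper_mean_bound ::
    "real \<Rightarrow> real set \<Rightarrow> nat \<Rightarrow> ((nat \<Rightarrow> real) \<Rightarrow> real) \<Rightarrow> (nat \<Rightarrow> real) \<Rightarrow> real" where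
  "upper_mean_bound \<alpha> E n T x =
    quantile (Pi\<^sub>M {1..n} (\<lambda>_. uniform_measure lborel {0..1})) (1 - \<alpha>) (sup_mean E n T x)"

definition first_positive_index :: "nat \<Rightarrow> (nat \<Rightarrow> real) \<Rightarrow> nat" where
  "first_positive_index n l = (LEAST i. i \<in> {1..n} \<and> sorted_entry n l i > 0)"

end

theory Submission
  imports Defs
begin

text \<open>
  Write \<open>d\<^sub>i = x\<^sub>(\<^sub>i\<^sub>+\<^sub>1\<^sub>) - x\<^sub>(\<^sub>i\<^sub>)\<close>, so that \<open>m(x, u) = b - (\<Sum>i. u\<^sub>(\<^sub>i\<^sub>) d\<^sub>i)\<close>. The quantile transform
  shows that among all distributions on \<open>[a, b]\<close> the uniform one has the smallest coverage, so
  exactness means that the event \<open>A = {\<forall>i. \<ell>\<^sub>(\<^sub>i\<^sub>) \<le> U\<^sub>(\<^sub>i\<^sub>)}\<close> has probability \<open>1 - \<alpha>\<close>.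

  With \<open>c = b - m(x, \<ell>)\<close>, the number \<open>b - b\<^sub>T(x, u)\<close> is the value of the linear program minimising
  \<open>\<Sum>i. u\<^sub>(\<^sub>i\<^sub>) d\<^sub>i\<close> subject to \<open>\<Sum>i. \<ell>\<^sub>(\<^sub>i\<^sub>) d\<^sub>i \<ge> c\<close>, \<open>\<Sum>i. d\<^sub>i \<le> b - a\<close> and \<open>d \<ge> 0\<close>. On \<open>A\<close> the value is at least \<open>c\<close>.
  If \<open>c / \<ell>\<^sub>(\<^sub>i\<^sub>0\<^sub>) \<le> b - a\<close>, the points with the single nonzero gap \<open>d\<^sub>i = c / \<ell>\<^sub>(\<^sub>i\<^sub>)\<close> are feasible and show
  that the value exceeds \<open>c\<close> by a given amount only on a subset of \<open>A\<close> of strictly smaller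
  probability. Otherwise the gap \<open>d\<^sub>i\<^sub>0\<close> alone cannot reach \<open>c\<close>, so every feasible point has a gap of
  index above \<open>i0\<close>; the value therefore stays above \<open>c\<close> also on a box outside \<open>A\<close> where \<open>U\<^sub>(\<^sub>i\<^sub>0\<^sub>)\<close> is
  slightly below \<open>\<ell>\<^sub>(\<^sub>i\<^sub>0\<^sub>)\<close> and the later order statistics are large.
\<close>

section \<open>Order statistics\<close>

text \<open>Sorting keeps the multiset of entries, and in the sorted list those at most
  \<open>t\<close> form an initial segment. The monotonicity and measurability of order statistics
  are read off from this counting form.\<close>

lemma sorted_entry_le_iff:
  assumes "i \<in> {1..n}"
  shows "sorted_entry n v i \<le> t \<longleftrightarrow> i \<le> card {j \<in> {1..n}. v j \<le> t}"
proof -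
  define xs where "xs = map v [1..<Suc n]"
  define ys where "ys = sort xs"
  have len: "length ys = n" and sorted: "sorted ys"
    by (simp_all add: ys_def xs_def del: upt_Suc)
  have "card {k. k < length ys \<and> ys ! k \<le> t} = length (filter (\<lambda>x. x \<le> t) ys)"
    by (simp add: length_filter_conv_card)
  also have "\<dots> = size (filter_mset (\<lambda>x. x \<le> t) (mset ys))"
    by (metis mset_filter size_mset)
  also have "mset ys = mset xs"
    by (simp add: ys_def)
  also have "size (filter_mset (\<lambda>x. x \<le> t) (mset xs)) = length (filter (\<lambda>x. x \<le> t) xs)"
    by (metis mset_filter size_mset)
  also have "\<dots> = length (filter (\<lambda>j. v j \<le> t) [1..<Suc n])"
    by (simp add: xs_def filter_map o_def del: upt_Suc)
  also have "\<dots> = card {j \<in> {1..n}. v j \<le> t}"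
  proof -
    have "distinct (filter (\<lambda>j. v j \<le> t) [1..<Suc n])"
      by (simp del: upt_Suc)
    moreover have "set (filter (\<lambda>j. v j \<le> t) [1..<Suc n]) = {j \<in> {1..n}. v j \<le> t}"
      by (auto simp del: upt_Suc)
    ultimately show ?thesis
      by (metis distinct_card)
  qed
  finally have card: "card {j \<in> {1..n}. v j \<le> t} = card {k. k < n \<and> ys ! k \<le> t}"
    by (simp add: len)
  have entry: "sorted_entry n v i = ys ! (i - 1)"
    by (simp add: sorted_entry_def ys_def xs_def del: upt_Suc)
  show ?thesis
  proof
    assume "sorted_entry n v i \<le> t"
    then have "ys ! k \<le> t" if "k < i" for k
    proof -
      have "ys ! k \<le> ys ! (i - 1)"
        using that assms len by (intro sorted_nth_mono[OF sorted]) auto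
      then show ?thesis
        using \<open>sorted_entry n v i \<le> t\<close> entry by simp
    qed
    then have "{..<i} \<subseteq> {k. k < n \<and> ys ! k \<le> t}"
      using assms by auto
    then have "card {..<i} \<le> card {k. k < n \<and> ys ! k \<le> t}"
      by (intro card_mono) auto
    then show "i \<le> card {j \<in> {1..n}. v j \<le> t}"
      by (simp only: card card_lessThan)
  next
    assume le: "i \<le> card {j \<in> {1..n}. v j \<le> t}"
    show "sorted_entry n v i \<le> t"
    proof (rule ccontr)
      assume "\<not> sorted_entry n v i \<le> t"
      then have "\<not> ys ! k \<le> t" if "i - 1 \<le> k" "k < n" for k
        using sorted_nth_mono[OF sorted, of "i - 1" k] that len entry by simp
      then have "{k. k < n \<and> ys ! k \<le> t} \<subseteq> {..<i - 1}"
        by (force simp: not_le[symmetric])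
      then have "card {k. k < n \<and> ys ! k \<le> t} \<le> card {..<i - 1}"
        by (intro card_mono) auto
      then show False
        using le assms unfolding card by simp linarith
    qed
  qed
qed

lemma sorted_entry_in_image:
  assumes "i \<in> {1..n}"
  shows "sorted_entry n v i \<in> v ` {1..n}"
proof -
  have "sort (map v [1..<Suc n]) ! (i - 1) \<in> set (sort (map v [1..<Suc n]))"
    using assms by (intro nth_mem) (auto simp del: upt_Suc)
  then show ?thesis
    unfolding sorted_entry_def by (simp del: upt_Suc add: atLeastLessThanSuc_atLeastAtMost)
qed

lemma sorted_entry_mem:
  assumes "v \<in> vecs n E" "i \<in> {1..n}"
  shows "sorted_entry n v i \<in> E"
  using sorted_entry_in_image[OF assms(2), of v] assms(1) by (auto simp: PiE_iff)

lemma sorted_entry_mono_index: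
  assumes "i \<in> {1..n}" "j \<in> {1..n}" "i \<le> j"
  shows "sorted_entry n v i \<le> sorted_entry n v j"
  using sorted_entry_le_iff[OF assms(1), of v "sorted_entry n v j"]
    sorted_entry_le_iff[OF assms(2), of v "sorted_entry n v j"] assms(3) by simp

lemma sorted_entry_mono:
  assumes "i \<in> {1..n}" "\<And>j. j \<in> {1..n} \<Longrightarrow> v j \<le> w j"
  shows "sorted_entry n v i \<le> sorted_entry n w i"
proof -
  have "i \<le> card {j \<in> {1..n}. w j \<le> sorted_entry n w i}"
    using sorted_entry_le_iff[OF assms(1)] by blast
  also have "\<dots> \<le> card {j \<in> {1..n}. v j \<le> sorted_entry n w i}"
    using assms(2) by (intro card_mono) (auto intro: order_trans)
  finally show ?thesis
    using sorted_entry_le_iff[OF assms(1)] by blast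
qed

lemma sorted_entry_of_mono_on:
  assumes "i \<in> {1..n}" "mono_on {1..n} v"
  shows "sorted_entry n v i = v i"
proof -
  have "sorted (map v [1..<Suc n])"
    using assms(2) by (auto simp: sorted_iff_nth_mono mono_on_def simp del: upt_Suc)
  moreover have "map v [1..<Suc n] ! (i - 1) = v i"
    using assms(1) by (subst nth_map) (auto simp del: upt_Suc)
  ultimately show ?thesis
    by (simp add: sorted_entry_def sorted_sort_id del: upt_Suc)
qed

lemma sorted_entry_comp_mono:
  assumes "i \<in> {1..n}" "mono g"
  shows "sorted_entry n (\<lambda>j. g (v j)) i = g (sorted_entry n v i)"
proof -
  have "map g (sort (map v [1..<Suc n])) = sort (map (\<lambda>j. g (v j)) [1..<Suc n])"
    using assms(2)
    by (intro properties_for_sort[symmetric])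
      (simp_all add: sorted_map sorted_wrt_mono_rel[OF _ sorted_sort] monoD multiset.map_comp o_def del: upt_Suc)
  moreover have "map g (sort (map v [1..<Suc n])) ! (i - 1) = g (sort (map v [1..<Suc n]) ! (i - 1))"
    using assms(1) by (intro nth_map) (auto simp del: upt_Suc)
  ultimately show ?thesis
    by (simp add: sorted_entry_def del: upt_Suc)
qed

lemma sorted_entry_cong:
  assumes "\<And>j. j \<in> {1..n} \<Longrightarrow> v j = w j"
  shows "sorted_entry n v i = sorted_entry n w i"
proof -
  have "map v [1..<Suc n] = map w [1..<Suc n]"
    using assms by (intro map_cong) auto
  then show ?thesis
    by (simp only: sorted_entry_def)
qed

text \<open>The number of entries at most \<open>t\<close> is a finite sum of indicators of
  coordinates, so the sublevel sets are measurable.\<close>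

lemma measurable_sorted_entry:
  assumes i: "i \<in> {1..n}" and M [measurable_cong]: "sets M = sets borel"
  shows "(\<lambda>v. sorted_entry n v i) \<in> borel_measurable (Pi\<^sub>M {1..n} (\<lambda>_. M))"
proof (rule borel_measurableI_le)
  fix t :: real
  have "real (card {j \<in> {1..n}. v j \<le> t}) = (\<Sum>j\<in>{1..n}. indicator {..t} (v j))" for v :: "nat \<Rightarrow> real"
    by (simp add: indicator_def sum.If_cases Int_def)
  then have *: "sorted_entry n v i \<le> t \<longleftrightarrow> real i \<le> (\<Sum>j\<in>{1..n}. indicator {..t} (v j))" for v
    unfolding sorted_entry_le_iff[OF i] of_nat_le_iff[where 'a = real, symmetric] by (rule arg_cong)
  show "{v \<in> space (Pi\<^sub>M {1..n} (\<lambda>_. M)). sorted_entry n v i \<le> t} \<in> sets (Pi\<^sub>M {1..n} (\<lambda>_. M))"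
    unfolding * by measurable
qed

section \<open>Induced means\<close>

text \<open>In these coordinates the mean is affine. No gap is counted below the smallest entry, so
  the total may fall short of \<open>b - a\<close>; this is what turns the range constraint into an
  inequality.\<close>

definition gap :: "real set \<Rightarrow> nat \<Rightarrow> (nat \<Rightarrow> real) \<Rightarrow> nat \<Rightarrow> real" where
  "gap E n x i = sample_entry E n x (i + 1) - sample_entry E n x i"

lemma gap_nonneg:
  assumes "x \<in> vecs n {a..b}" "i \<in> {1..n}"
  shows "0 \<le> gap {a..b} n x i"
  using sample_entry_mono[OF assms(1), of i "i + 1"] assms(2) by (simp add: gap_def)

lemma sum_gap:
  assumes "a \<le> b" "i \<in> {1..n}"
  shows "(\<Sum>j=i..n. gap {a..b} n x j) = b - sorted_entry n x i"
  using sum_Suc_diff[of i n "sample_entry {a..b} n x"] assms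
  by (simp add: gap_def sample_entry_def)

lemma induced_mean_gap:
  assumes "a \<le> b"
  shows "induced_mean {a..b} n x u = b - (\<Sum>i=1..n. sorted_entry n u i * gap {a..b} n x i)"
  unfolding induced_mean_alt using assms by (simp add: gap_def level_entry_def)

lemma induced_mean_le:
  assumes "a \<le> b" "x \<in> vecs n {a..b}" "u \<in> vecs n {0..1}"
  shows "induced_mean {a..b} n x u \<le> b"
  unfolding induced_mean_gap[OF assms(1)]
  using gap_nonneg[OF assms(2)] sorted_entry_mem[OF assms(3)]
  by (auto intro!: sum_nonneg mult_nonneg_nonneg)

lemma gap_le:
  assumes "x \<in> vecs n {a..b}" "i \<in> {1..n}"
  shows "gap {a..b} n x i \<le> b - a"
proof -
  have ab: "a \<le> b"
    using sorted_entry_mem[OF assms] by simp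
  have "gap {a..b} n x i \<le> (\<Sum>j=i..n. gap {a..b} n x j)"
    using gap_nonneg[OF assms(1)] assms(2) by (intro member_le_sum) auto
  also have "\<dots> \<le> b - a"
    using sum_gap[OF ab assms(2)] sorted_entry_mem[OF assms] by simp
  finally show ?thesis .
qed

text \<open>A real supremum is meaningful only over a nonempty bounded set. The bound uses absolute
  values because \<open>u\<close> ranges over the whole sample space, not just the unit
  cube.\<close>

lemma sup_mean_le_iff:
  assumes "a \<le> b" "x \<in> vecs n {a..b}"
  shows "sup_mean {a..b} n T x u \<le> y \<longleftrightarrow>
    (\<forall>z \<in> sublevel_set {a..b} n T x. induced_mean {a..b} n z u \<le> y)"
proof -
  have "x \<in> sublevel_set {a..b} n T x"
    using assms by (simp add: sublevel_set_def)
  moreover have "induced_mean {a..b} n z u \<le> b + (\<Sum>i=1..n. \<bar>sorted_entry n u i\<bar> * (b - a))"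
    if "z \<in> vecs n {a..b}" for z
  proof -
    have "(\<Sum>i=1..n. - (sorted_entry n u i * gap {a..b} n z i)) \<le>
        (\<Sum>i=1..n. \<bar>sorted_entry n u i\<bar> * (b - a))"
    proof (intro sum_mono)
      fix i assume i: "i \<in> {1..n}"
      have "- (sorted_entry n u i * gap {a..b} n z i) \<le> \<bar>sorted_entry n u i\<bar> * gap {a..b} n z i"
        using mult_right_mono[OF _ gap_nonneg[OF that i], of "- sorted_entry n u i" "\<bar>sorted_entry n u i\<bar>"]
        by simp
      also have "\<dots> \<le> \<bar>sorted_entry n u i\<bar> * (b - a)"
        using gap_le[OF that i] by (simp add: mult_left_mono)
      finally show "- (sorted_entry n u i * gap {a..b} n z i) \<le> \<bar>sorted_entry n u i\<bar> * (b - a)" .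
    qed
    then show ?thesis
      by (simp add: induced_mean_gap[OF assms(1)] sum_negf)
  qed
  then have "bdd_above ((\<lambda>z. induced_mean {a..b} n z u) ` sublevel_set {a..b} n T x)"
    by (intro bdd_aboveI[of _ "b + (\<Sum>i=1..n. \<bar>sorted_entry n u i\<bar> * (b - a))"])
      (auto simp: sublevel_set_def)
  ultimately show ?thesis
    unfolding sup_mean_def by (subst cSUP_le_iff) auto
qed

text \<open>
  The supremum may be restricted to a countable dense set of gap vectors. Measurability matters,
  as the \<^const>\<open>distr\<close> of a non-measurable function is the null measure.
\<close>

lemma measurable_sup_mean:
  assumes "a \<le> b" "x \<in> vecs n {a..b}" and M: "sets M = sets borel"
  shows "sup_mean {a..b} n T x \<in> borel_measurable (Pi\<^sub>M {1..n} (\<lambda>_. M))"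
proof (rule borel_measurableI_le)
  fix y
  define G where "G = gap {a..b} n ` sublevel_set {a..b} n T x"
  obtain K where K: "countable K" "K \<subseteq> G" "G \<subseteq> closure K"
    by (rule separable)
  have *: "sup_mean {a..b} n T x u \<le> y \<longleftrightarrow> (\<forall>d\<in>K. b - (\<Sum>i=1..n. sorted_entry n u i * d i) \<le> y)" for u
  proof -
    let ?C = "{d. b - (\<Sum>i=1..n. sorted_entry n u i * d i) \<le> y}"
    have "sup_mean {a..b} n T x u \<le> y \<longleftrightarrow> G \<subseteq> ?C"
      by (auto simp: sup_mean_le_iff[OF assms(1,2)] G_def induced_mean_gap[OF assms(1)])
    also have "\<dots> \<longleftrightarrow> K \<subseteq> ?C"
    proof -
      \<comment> \<open>For fixed \<open>u\<close> the constraint involves finitely many coordinates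
        of \<open>d\<close>, so it is closed in the product topology and passes from
        \<open>K\<close> to its closure.\<close>
      have "closed ?C"
        by (intro closed_Collect_le continuous_intros continuous_on_product_coordinates)
      then show ?thesis
        using K by (meson closure_minimal order_trans)
    qed
    finally show ?thesis
      by auto
  qed
  have [measurable]: "(\<lambda>u. sorted_entry n u i) \<in> borel_measurable (Pi\<^sub>M {1..n} (\<lambda>_. M))"
    if "i \<in> {1..n}" for i
    using measurable_sorted_entry[OF that M] .
  show "{u \<in> space (Pi\<^sub>M {1..n} (\<lambda>_. M)). sup_mean {a..b} n T x u \<le> y} \<in> sets (Pi\<^sub>M {1..n} (\<lambda>_. M))"
    unfolding * using K(1) by measurable
qed

section \<open>Uniform samples\<close>

abbreviation unif :: "real measure" where
  "unif \<equiv> uniform_measure lborel {0..1}"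

abbreviation unif_sample :: "nat \<Rightarrow> (nat \<Rightarrow> real) measure" where
  "unif_sample n \<equiv> Pi\<^sub>M {1..n} (\<lambda>_. unif)"

lemma prob_space_unif: "prob_space unif"
  by (intro prob_space_uniform_measure) auto

lemma measure_unif_atMost: "measure unif {..t} = min 1 (max 0 t)"
proof -
  have "{0..1} \<inter> {..t} = {0..min 1 t}"
    by auto
  then show ?thesis
    by (simp add: measure_uniform_measure)
qed

lemma AE_unif_Ioo: "AE t in unif. t \<in> {0<..<1}"
proof (intro AE_uniform_measureI)
  show "AE t in lborel. t \<in> {0..1} \<longrightarrow> t \<in> {0<..<1::real}"
    using AE_lborel_singleton[of "0::real"] AE_lborel_singleton[of "1::real"]
    by eventually_elim auto
qed simp

lemma AE_unif_neq: "AE t in unif. t \<noteq> c"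
  using AE_lborel_singleton[of c] by (intro AE_uniform_measureI) auto

lemma AE_unif_sample_Ioo: "AE u in unif_sample n. u \<in> vecs n {0<..<1}"
proof -
  have "AE u in unif_sample n. \<forall>i\<in>{1..n}. u i \<in> {0<..<1}"
    using AE_unif_Ioo by (intro AE_finite_allI AE_PiM_component prob_space_unif) auto
  then show ?thesis
    using AE_space by eventually_elim (auto simp: space_PiM PiE_iff)
qed

lemma AE_unif_sample_sorted_neq:
  assumes "i \<in> {1..n}"
  shows "AE u in unif_sample n. sorted_entry n u i \<noteq> c"
proof -
  have "AE u in unif_sample n. \<forall>i\<in>{1..n}. u i \<noteq> c"
    using AE_unif_neq by (intro AE_finite_allI AE_PiM_component prob_space_unif) auto
  then show ?thesis
  proof eventually_elim
    case (elim u)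
    then show ?case
      using sorted_entry_in_image[OF assms, of u] by auto
  qed
qed

text \<open>Both comparisons with \<open>1 - \<alpha>\<close> below become strict by adjoining such
  a box to an event.\<close>

lemma measure_unif_sample_box_pos:
  assumes "\<And>i. i \<in> {1..n} \<Longrightarrow> 0 \<le> p i \<and> p i < q i \<and> q i \<le> 1"
  shows "measure (unif_sample n) (\<Pi>\<^sub>E i\<in>{1..n}. {p i<..<q i}) > 0"
proof -
  interpret U: prob_space unif by (rule prob_space_unif)
  interpret finite_product_prob_space "\<lambda>_::nat. unif" "{1..n}" by standard auto
  have "measure unif {p i<..<q i} > 0" if "i \<in> {1..n}" for i
  proof -
    have "{0..1} \<inter> {p i<..<q i} = {p i<..<q i}"
      using assms[OF that] by auto
    then show ?thesis
      using assms[OF that] by (simp add: measure_uniform_measure)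
  qed
  then show ?thesis
    by (subst finite_measure_PiM_emb) (auto intro!: prod_pos)
qed

section \<open>Coverage of the step function\<close>

lemma cdf_distribution_on:
  assumes "distribution_on {a..b} M" "b \<le> t"
  shows "cdf M t = 1"
proof -
  interpret real_distribution M
    using assms(1) by (simp add: distribution_on_def)
  have "AE s in M. s \<in> {..t}"
    using assms by (auto simp: distribution_on_def elim!: AE_mp)
  then show ?thesis
    by (simp add: cdf_def prob_eq_1)
qed

text \<open>Take the largest index whose entry is at most \<open>t\<close>; for index
  \<open>n\<close> the next entry is \<open>Sup E\<close>, beyond \<open>t\<close>. The maximality
  clause serves tied entries.\<close>

lemma ex_sample_entry_interval:
  assumes "1 \<le> n" "sorted_entry n X 1 \<le> t" "t < Sup E"
  shows "\<exists>j\<in>{1..n}. sample_entry E n X j \<le> t \<and> t < sample_entry E n X (j + 1) \<and>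
    (\<forall>i\<in>{1..n}. sample_entry E n X i \<le> t \<longrightarrow> i \<le> j)"
proof -
  define J where "J = {i \<in> {1..n}. sample_entry E n X i \<le> t}"
  have J: "finite J" "1 \<in> J"
    using assms by (simp_all add: J_def sample_entry_def)
  then have "Max J \<in> J"
    by (intro Max_in) auto
  moreover have "t < sample_entry E n X (Max J + 1)"
  proof (rule ccontr)
    assume neg: "\<not> t < sample_entry E n X (Max J + 1)"
    then have "Max J \<noteq> n"
      using assms(3) by (auto simp: sample_entry_def)
    with neg \<open>Max J \<in> J\<close> have "Max J + 1 \<in> J"
      by (auto simp: J_def)
    then show False
      using Max_ge[OF J(1)] by fastforce
  qed
  moreover have "i \<le> Max J" if "i \<in> {1..n}" "sample_entry E n X i \<le> t" for i
    using that J(1) by (intro Max_ge) (auto simp: J_def)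
  ultimately show ?thesis
    unfolding J_def by blast
qed

text \<open>Below \<open>b\<close> the step function jumps only at order statistics while a CDF is
  nondecreasing, so it suffices to test there. At ties the step function takes the level of the last
  tied index, which dominates the levels of the others.\<close>

lemma step_bound_le_cdf_iff:
  assumes "1 \<le> n" "a \<le> b" "distribution_on {a..b} M" "X \<in> vecs n {a..b}" "l \<in> vecs n {0..1}"
  shows "(\<forall>t. step_bound {a..b} n X l t \<le> cdf M t) \<longleftrightarrow>
    (\<forall>i\<in>{1..n}. sorted_entry n l i \<le> cdf M (sorted_entry n X i))"
proof -
  interpret real_distribution M
    using assms(3) by (simp add: distribution_on_def)
  have Sup: "Sup {a..b} = b"
    using assms(2) by simp
  note step = step_bound_eq[OF assms(4) bdd_above_Icc]
  have entry: "sample_entry {a..b} n X i = sorted_entry n X i" if "i \<in> {1..n}" for i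
    using that by (simp add: sample_entry_def)
  show ?thesis
  proof (intro iffI allI ballI)
    fix i assume le: "\<forall>t. step_bound {a..b} n X l t \<le> cdf M t" and i: "i \<in> {1..n}"
    show "sorted_entry n l i \<le> cdf M (sorted_entry n X i)"
    proof (cases "sorted_entry n X i < b")
      case True
      then obtain j where j: "j \<in> {1..n}"
        "sample_entry {a..b} n X j \<le> sorted_entry n X i"
        "sorted_entry n X i < sample_entry {a..b} n X (j + 1)" "i \<le> j"
      proof -
        have "sorted_entry n X 1 \<le> sorted_entry n X i"
          using i by (intro sorted_entry_mono_index) auto
        then show ?thesis
          using ex_sample_entry_interval[of n X "sorted_entry n X i" "{a..b}"]
            that assms(1) True i entry[OF i] unfolding Sup by (metis order_refl)
      qed
      have "sorted_entry n l i \<le> sorted_entry n l j"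
        using i j by (intro sorted_entry_mono_index)
      also have "\<dots> = step_bound {a..b} n X l (sorted_entry n X i)"
        using step(2) j by simp
      finally show ?thesis
        using le order_trans by blast
    next
      \<comment> \<open>An entry equal to \<open>b\<close> starts only an empty interval of the step
        function, but there the CDF is already 1.\<close>
      case False
      then show ?thesis
        using cdf_distribution_on[OF assms(3)] sorted_entry_mem[OF assms(5) i] by simp
    qed
  next
    fix t assume le: "\<forall>i\<in>{1..n}. sorted_entry n l i \<le> cdf M (sorted_entry n X i)"
    consider "t < sorted_entry n X 1" | "b \<le> t" | "sorted_entry n X 1 \<le> t" "t < b"
      by linarith
    then show "step_bound {a..b} n X l t \<le> cdf M t"
    proof cases
      case 1
      then show ?thesis
        using step(1) assms(1) cdf_nonneg by simp
    next
      case 2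
      then show ?thesis
        using step(3) Sup cdf_distribution_on[OF assms(3)] by simp
    next
      case 3
      then obtain j where j: "j \<in> {1..n}"
        "sample_entry {a..b} n X j \<le> t" "t < sample_entry {a..b} n X (j + 1)"
        using ex_sample_entry_interval[of n X t "{a..b}"] assms(1) unfolding Sup by blast
      then have "step_bound {a..b} n X l t = sorted_entry n l j"
        using step(2) by simp
      also have "\<dots> \<le> cdf M (sorted_entry n X j)"
        using le j(1) by blast
      also have "\<dots> \<le> cdf M t"
        using j(2) entry[OF j(1)] by (intro cdf_nondecreasing) simp
      finally show ?thesis .
    qed
  qed
qed

text \<open>
  A non-measurable coverage event would have \<^const>\<open>measure\<close> zero, so positive coverage gives
  measurability for free.
\<close>

lemma coverage_transform:
  assumes M: "distr unif borel f = M" and f: "f \<in> borel_measurable unif" and "coverage n H M \<noteq> 0"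
  shows "{u \<in> space (unif_sample n). \<forall>t. H (compose {1..n} f u) t \<le> cdf M t} \<in> sets (unif_sample n)"
    and "measure (unif_sample n) {u \<in> space (unif_sample n). \<forall>t. H (compose {1..n} f u) t \<le> cdf M t} =
      coverage n H M"
proof -
  let ?P = "Pi\<^sub>M {1..n} (\<lambda>_. M)"
  let ?S = "{X \<in> space ?P. \<forall>t. cdf M t \<ge> H X t}"
  have borel_prob: "prob_space M" "sets M = sets borel"
    using M prob_space.prob_space_distr[OF prob_space_unif f] by auto
  have "?S \<in> sets ?P"
    using assms(3) by (auto simp: coverage_def intro!: measure_notin_sets)
  have distr: "distr (unif_sample n) ?P (compose {1..n} f) = ?P"
  proof -
    have "distr (unif_sample n) ?P (compose {1..n} f) = Pi\<^sub>M {1..n} (\<lambda>_. distr unif M f)"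
      using f borel_prob by (intro distr_PiM_finite_prob_space' prob_space_unif) (auto cong: measurable_cong_sets)
    also have "distr unif M f = M"
      using M borel_prob(2) by (metis distr_cong)
    finally show ?thesis .
  qed
  have meas: "compose {1..n} f \<in> measurable (unif_sample n) ?P"
    using f borel_prob(2) unfolding compose_def
    by (intro measurable_restrict measurable_compose[OF measurable_component_singleton])
      (auto cong: measurable_cong_sets)
  have vimage: "{u \<in> space (unif_sample n). \<forall>t. H (compose {1..n} f u) t \<le> cdf M t} =
      compose {1..n} f -` ?S \<inter> space (unif_sample n)"
    using measurable_space[OF meas] by auto
  show "{u \<in> space (unif_sample n). \<forall>t. H (compose {1..n} f u) t \<le> cdf M t} \<in> sets (unif_sample n)"
    unfolding vimage by (rule measurable_sets[OF meas \<open>?S \<in> sets ?P\<close>])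
  show "measure (unif_sample n) {u \<in> space (unif_sample n). \<forall>t. H (compose {1..n} f u) t \<le> cdf M t} =
      coverage n H M"
    unfolding vimage coverage_def
    by (subst measure_distr[OF meas \<open>?S \<in> sets ?P\<close>, symmetric]) (simp only: distr)
qed

section \<open>Extremal coverage: quantile transform and uniform distribution\<close>

definition exceeding :: "nat \<Rightarrow> (nat \<Rightarrow> real) \<Rightarrow> (nat \<Rightarrow> real) set" where
  "exceeding n l = {u \<in> space (unif_sample n). \<forall>i\<in>{1..n}. sorted_entry n l i \<le> sorted_entry n u i}"

lemma sets_exceeding: "exceeding n l \<in> sets (unif_sample n)"
  using measurable_sorted_entry[of _ n unif] unfolding exceeding_def
  by (intro sets.sets_Collect_finite_All borel_measurable_le) auto

interpretation unif_sample: prob_space "unif_sample n" for n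
  by (intro prob_space_PiM prob_space_unif)

text \<open>Realise the sample from \<open>M\<close> as the quantile transform \<open>I\<close> of a
  uniform sample \<open>u\<close>. Each \<open>u j\<close> is at most the CDF at
  \<open>I (u j)\<close>, and sorting commutes with the monotone CDF, so levels dominated by the
  order statistics of \<open>u\<close> are dominated by the CDF values.\<close>

lemma measure_exceeding_le_coverage:
  assumes "1 \<le> n" "a \<le> b" "l \<in> vecs n {0..1}" "distribution_on {a..b} M"
    and "coverage n (\<lambda>X. step_bound {a..b} n X l) M \<noteq> 0"
  shows "measure (unif_sample n) (exceeding n l) \<le> coverage n (\<lambda>X. step_bound {a..b} n X l) M"
proof -
  interpret real_distribution M
    using assms(4) by (simp add: distribution_on_def)
  interpret C: cdf_distribution M
    by unfold_locales
  \<comment> \<open>Outside the open unit interval the infimum may run over an empty or unbounded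
    set; the default 0 affects only a null set.\<close>
  define I where "I w = (if w \<in> {0<..<1} then Inf {x. w \<le> cdf M x} else 0)" for w
  have I_le_iff: "I w \<le> x \<longleftrightarrow> w \<le> cdf M x" if "w \<in> {0<..<1}" for w x
    using C.pseudoinverse[of w x] that by (simp add: I_def)
  have "I \<in> borel_measurable borel"
  proof -
    have eq: "{w. 0 < w \<and> w < 1} = {0<..<1::real}"
      by auto
    have "(\<lambda>w. if w \<in> {0<..<1} then Inf {x. w \<le> cdf M x} else 0) \<in> borel_measurable borel"
      using C.measurable_CI eq
      by (intro measurable_If_restrict_space_iff[THEN iffD2] conjI) auto
    then show ?thesis
      by (simp add: I_def[abs_def])
  qed
  then have meas: "I \<in> borel_measurable unif"
    by simp
  have M: "distr unif borel I = M"
  proof (rule cdf_unique)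
    show "real_distribution (distr unif borel I)"
      using meas prob_space.real_distribution_distr[OF prob_space_unif] by simp
    show "cdf (distr unif borel I) = cdf M"
    proof
      fix x
      have "cdf (distr unif borel I) x = measure unif (I -` {..x} \<inter> space unif)"
        using meas by (simp add: cdf_def measure_distr)
      also have "\<dots> = measure unif {..cdf M x}"
      proof (rule measure_eq_AE)
        show "AE w in unif. w \<in> I -` {..x} \<inter> space unif \<longleftrightarrow> w \<in> {..cdf M x}"
          using AE_unif_Ioo by eventually_elim (simp add: I_le_iff)
      qed (use measurable_sets[OF meas, of "{..x}"] in auto)
      also have "\<dots> = cdf M x"
        using cdf_nonneg[of x] cdf_bounded_prob[of x] by (simp add: measure_unif_atMost)
      finally show "cdf (distr unif borel I) x = cdf M x" .
    qed
  qed unfold_locales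
  have "AE w in unif. I w \<in> {a..b}"
    using assms(4) AE_distrD[OF meas, of "\<lambda>t. t \<in> {a..b}"] unfolding M by (simp add: distribution_on_def)
  then have AE_I: "AE u in unif_sample n. \<forall>i\<in>{1..n}. I (u i) \<in> {a..b}"
    by (intro AE_finite_allI AE_PiM_component prob_space_unif) auto
  note cov = coverage_transform[OF M meas assms(5)]
  have "measure (unif_sample n) (exceeding n l) \<le> measure (unif_sample n)
      {u \<in> space (unif_sample n). \<forall>t. step_bound {a..b} n (compose {1..n} I u) l t \<le> cdf M t}"
  proof (rule unif_sample.finite_measure_mono_AE[OF _ cov(1)])
    show "AE u in unif_sample n. u \<in> exceeding n l \<longrightarrow>
        u \<in> {u \<in> space (unif_sample n). \<forall>t. step_bound {a..b} n (compose {1..n} I u) l t \<le> cdf M t}"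
      using AE_I AE_unif_sample_Ioo
    proof eventually_elim
      case (elim u)
      let ?X = "compose {1..n} I u"
      have X: "?X \<in> vecs n {a..b}"
        using elim(1) by (auto simp: compose_def)
      show ?case
      proof
        assume u: "u \<in> exceeding n l"
        have "sorted_entry n l i \<le> cdf M (sorted_entry n ?X i)" if i: "i \<in> {1..n}" for i
        proof -
          have "sorted_entry n l i \<le> sorted_entry n u i"
            using u i by (auto simp: exceeding_def)
          also have "\<dots> \<le> sorted_entry n (\<lambda>j. cdf M (?X j)) i"
          proof (rule sorted_entry_mono[OF i])
            fix j assume j: "j \<in> {1..n}"
            then have "u j \<in> {0<..<1}"
              using elim(2) by auto
            \<comment> \<open>The Galois property of \<open>I\<close>, evaluated at the point
              \<open>I (u j)\<close> itself.\<close>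
            then show "u j \<le> cdf M (?X j)"
              using I_le_iff[of "u j" "I (u j)"] j by (simp add: compose_def)
          qed
          also have "\<dots> = cdf M (sorted_entry n ?X i)"
            using i by (intro sorted_entry_comp_mono monoI cdf_nondecreasing)
          finally show ?thesis .
        qed
        then show "u \<in> {u \<in> space (unif_sample n).
            \<forall>t. step_bound {a..b} n (compose {1..n} I u) l t \<le> cdf M t}"
          using step_bound_le_cdf_iff[OF assms(1,2,4) X assms(3)] u by (auto simp: exceeding_def)
      qed
    qed
  qed
  then show ?thesis
    by (simp only: cov(2))
qed

text \<open>The witness is the uniform distribution on \<open>{a..b}\<close>. Its CDF inverts the
  affine map \<open>f\<close> on the open unit interval, so the CDF values at the sorted sample are
  exactly the uniform order statistics.\<close>

lemma ex_coverage_le_measure_exceeding: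
  assumes "1 \<le> n" "a < b" "l \<in> vecs n {0..1}"
    and pos: "\<And>M. distribution_on {a..b} M \<Longrightarrow> coverage n (\<lambda>X. step_bound {a..b} n X l) M \<noteq> 0"
  shows "\<exists>M. distribution_on {a..b} M \<and>
    coverage n (\<lambda>X. step_bound {a..b} n X l) M \<le> measure (unif_sample n) (exceeding n l)"
proof -
  define f where "f w = a + (b - a) * w" for w
  define M where "M = distr unif borel f"
  have f_le_iff: "f v \<le> f w \<longleftrightarrow> v \<le> w" for v w
    using assms(2) by (simp add: f_def)
  have f_mem: "f w \<in> {a..b}" if "w \<in> {0<..<1}" for w
    using f_le_iff[of 0 w] f_le_iff[of w 1] that by (simp add: f_def)
  have meas: "f \<in> borel_measurable unif"
    by (simp add: f_def[abs_def])
  interpret real_distribution M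
    using meas prob_space.real_distribution_distr[OF prob_space_unif] by (simp add: M_def)
  have "AE t in M. t \<in> {a..b}"
  proof -
    have "AE w in unif. f w \<in> {a..b}"
      using AE_unif_Ioo f_mem by (auto elim: AE_mp)
    then show ?thesis
      unfolding M_def using meas by (subst AE_distr_iff) auto
  qed
  then have dist: "distribution_on {a..b} M"
    by (simp add: distribution_on_def real_distribution_axioms)
  have cdf: "cdf M (f w) = w" if "w \<in> {0<..<1}" for w
  proof -
    have "cdf M (f w) = measure unif (f -` {..f w} \<inter> space unif)"
      using meas by (simp add: cdf_def M_def measure_distr)
    also have "f -` {..f w} \<inter> space unif = {..w}"
      by (auto simp: f_le_iff)
    finally show ?thesis
      using that by (simp add: measure_unif_atMost)
  qed
  note cov = coverage_transform[OF M_def[symmetric] meas pos[OF dist]]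
  have "measure (unif_sample n)
      {u \<in> space (unif_sample n). \<forall>t. step_bound {a..b} n (compose {1..n} f u) l t \<le> cdf M t}
      \<le> measure (unif_sample n) (exceeding n l)"
  proof (rule unif_sample.finite_measure_mono_AE)
    show "AE u in unif_sample n. u \<in> {u \<in> space (unif_sample n).
        \<forall>t. step_bound {a..b} n (compose {1..n} f u) l t \<le> cdf M t} \<longrightarrow> u \<in> exceeding n l"
      using AE_unif_sample_Ioo
    proof eventually_elim
      case (elim u)
      let ?X = "compose {1..n} f u"
      have X: "?X \<in> vecs n {a..b}"
        using elim f_mem by (auto simp: compose_def PiE_iff)
      have "cdf M (sorted_entry n ?X i) = sorted_entry n u i" if i: "i \<in> {1..n}" for i
      proof -
        have "sorted_entry n ?X i = sorted_entry n (\<lambda>j. f (u j)) i"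
          by (intro sorted_entry_cong) (simp add: compose_def)
        also have "\<dots> = f (sorted_entry n u i)"
          using i by (intro sorted_entry_comp_mono monoI) (simp_all add: f_le_iff)
        finally show ?thesis
          using cdf sorted_entry_mem[OF elim i] by simp
      qed
      then show ?case
        using step_bound_le_cdf_iff[OF assms(1) less_imp_le[OF assms(2)] dist X assms(3)]
        by (auto simp: exceeding_def)
    qed
  qed (rule sets_exceeding)
  then show ?thesis
    using dist unfolding cov(2) by blast
qed

text \<open>Applying the lower estimate to the distribution attaining \<open>1 - \<alpha>\<close>
  gives one inequality, the uniform distribution the other. Since \<open>\<alpha> < 1\<close>, all
  coverages are nonzero, as the transform requires.\<close>

lemma measure_exceeding:
  assumes "1 \<le> n" "a < b" "\<alpha> < 1" "l \<in> vecs n {0..1}"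
    and "exact_lower_confidence_bound {a..b} n \<alpha> (\<lambda>X. step_bound {a..b} n X l)"
  shows "measure (unif_sample n) (exceeding n l) = 1 - \<alpha>"
proof (rule antisym)
  let ?cov = "coverage n (\<lambda>X. step_bound {a..b} n X l)"
  have ge: "?cov M \<ge> 1 - \<alpha>" if "distribution_on {a..b} M" for M
    using assms(5) that
    by (simp add: exact_lower_confidence_bound_def lower_confidence_bound_def)
  then have nz: "?cov M \<noteq> 0" if "distribution_on {a..b} M" for M
    using that assms(3) by fastforce
  obtain M where "distribution_on {a..b} M" "?cov M = 1 - \<alpha>"
    using assms(5) by (auto simp: exact_lower_confidence_bound_def)
  then show "measure (unif_sample n) (exceeding n l) \<le> 1 - \<alpha>"
    using measure_exceeding_le_coverage[OF assms(1) less_imp_le[OF assms(2)] assms(4) _ nz] by metis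
  obtain M' where "distribution_on {a..b} M'" "?cov M' \<le> measure (unif_sample n) (exceeding n l)"
    using ex_coverage_le_measure_exceeding[OF assms(1,2,4) nz] by blast
  then show "1 - \<alpha> \<le> measure (unif_sample n) (exceeding n l)"
    using ge by fastforce
qed

section \<open>Quantiles\<close>

text \<open>By right continuity of the CDF and \<open>0 < p < 1\<close>, the infimum in the quantile
  is attained.\<close>

lemma quantile_le_iff:
  assumes "prob_space P" "Y \<in> borel_measurable P" "0 < p" "p < 1"
  shows "quantile P p Y \<le> y \<longleftrightarrow> p \<le> measure P {u \<in> space P. Y u \<le> y}"
proof -
  interpret cdf_distribution "distr P borel Y"
    using prob_space.real_distribution_distr[OF assms(1,2)] by (simp add: cdf_distribution_def)
  have "Y -` {..y} \<inter> space P = {u \<in> space P. Y u \<le> y}"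
    by auto
  then show ?thesis
    unfolding quantile_def using pseudoinverse[of p y] assms by (simp add: cdf_def measure_distr)
qed

text \<open>If the quantile were at least \<open>y\<close>, the CDF would be at most
  \<open>p\<close> everywhere left of \<open>y\<close>, and so would its left limit there, which is
  the probability of \<open>Y < y\<close>.\<close>

lemma quantile_less:
  assumes "prob_space P" "Y \<in> borel_measurable P" "0 < p" "p < 1"
    and "p < measure P {u \<in> space P. Y u < y}"
  shows "quantile P p Y < y"
proof (rule ccontr)
  assume neg: "\<not> quantile P p Y < y"
  interpret real_distribution "distr P borel Y"
    using prob_space.real_distribution_distr[OF assms(1,2)] .
  have "cdf (distr P borel Y) t \<le> p" if "t < y" for t
  proof -
    have "Y -` {..t} \<inter> space P = {u \<in> space P. Y u \<le> t}"
      by auto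
    then show ?thesis
      using quantile_le_iff[OF assms(1-4), of t] neg that assms(2) by (simp add: cdf_def measure_distr)
  qed
  then have "eventually (\<lambda>t. cdf (distr P borel Y) t \<le> p) (at_left y)"
    by (auto simp: eventually_at_filter)
  then have "measure (distr P borel Y) {..<y} \<le> p"
    using cdf_at_left by (intro tendsto_upperbound) auto
  moreover have "Y -` {..<y} \<inter> space P = {u \<in> space P. Y u < y}"
    by auto
  ultimately show False
    using assms(2,5) by (simp add: measure_distr)
qed

section \<open>The mean bound for the ordering induced by the levels\<close>

text \<open>Uniform order statistics are almost surely below 1, so a level equal to 1 would make the
  event null. The room above the levels is used to fit boxes.\<close>

lemma level_lt_1:
  assumes "l \<in> vecs n {0..1}" "0 < measure (unif_sample n) (exceeding n l)" "i \<in> {1..n}"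
  shows "sorted_entry n l i < 1"
proof (rule ccontr)
  assume neg: "\<not> sorted_entry n l i < 1"
  have "AE u in unif_sample n. u \<notin> exceeding n l"
    using AE_unif_sample_Ioo
  proof eventually_elim
    case (elim u)
    then show ?case
      using sorted_entry_mem[OF elim assms(3)] assms(3) neg by (force simp: exceeding_def)
  qed
  then have "measure (unif_sample n) (exceeding n l) = 0"
    using unif_sample.prob_eq_0[OF sets_exceeding] by blast
  then show False
    using assms(2) by simp
qed

text \<open>If all levels vanished, the event would be almost sure; hence the \<open>LEAST\<close>
  ranges over a nonempty set.\<close>

lemma first_positive_index:
  assumes "l \<in> vecs n {0..1}" "measure (unif_sample n) (exceeding n l) < 1"
  shows "first_positive_index n l \<in> {1..n}" "0 < sorted_entry n l (first_positive_index n l)"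
    and "i \<in> {1..n} \<Longrightarrow> i < first_positive_index n l \<Longrightarrow> sorted_entry n l i = 0"
proof -
  have "\<exists>i. i \<in> {1..n} \<and> sorted_entry n l i > 0"
  proof (rule ccontr)
    assume neg: "\<not> (\<exists>i. i \<in> {1..n} \<and> sorted_entry n l i > 0)"
    have "AE u in unif_sample n. u \<in> exceeding n l"
      using AE_unif_sample_Ioo AE_space
    proof eventually_elim
      case (elim u)
      have "sorted_entry n l i \<le> sorted_entry n u i" if "i \<in> {1..n}" for i
        using neg that sorted_entry_mem[OF elim(1) that] by (auto simp: not_less intro: order_trans)
      then show ?case
        using elim(2) by (simp add: exceeding_def)
    qed
    then have "measure (unif_sample n) (exceeding n l) = 1"
      using unif_sample.prob_eq_1[OF sets_exceeding] by blast
    then show False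
      using assms(2) by simp
  qed
  from LeastI_ex[OF this]
  show "first_positive_index n l \<in> {1..n}" "0 < sorted_entry n l (first_positive_index n l)"
    by (simp_all add: first_positive_index_def)
  show "sorted_entry n l i = 0" if "i \<in> {1..n}" "i < first_positive_index n l"
    using not_less_Least[of i "\<lambda>i. i \<in> {1..n} \<and> sorted_entry n l i > 0"] that
      sorted_entry_mem[OF assms(1) that(1)] by (force simp: first_positive_index_def)
qed

text \<open>These vectors, whose only possibly nonzero gap is the \<open>k\<close>-th, are the test
  points of the linear program.\<close>

lemma induced_mean_two_step:
  assumes "a \<le> p" "p \<le> b" "k \<in> {1..n}"
  defines "z \<equiv> \<lambda>j\<in>{1..n}. if j \<le> k then p else b"
  shows "z \<in> vecs n {a..b}" "induced_mean {a..b} n z u = b - sorted_entry n u k * (b - p)"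
proof -
  show "z \<in> vecs n {a..b}"
    using assms by auto
  have "sorted_entry n z i = z i" if "i \<in> {1..n}" for i
    using assms(2) that by (intro sorted_entry_of_mono_on) (auto simp: z_def mono_on_def)
  then have entry: "sample_entry {a..b} n z i = (if i \<le> k then p else b)" if "i \<in> {1..n+1}" for i
    using that assms(1-3) by (auto simp: sample_entry_def z_def)
  have "gap {a..b} n z i = (if i = k then b - p else 0)" if "i \<in> {1..n}" for i
    using entry[of i] entry[of "i + 1"] that unfolding gap_def by auto
  then have "(\<Sum>i=1..n. sorted_entry n u i * gap {a..b} n z i) =
      (\<Sum>i=1..n. if i = k then sorted_entry n u i * (b - p) else 0)"
    by (intro sum.cong) auto
  also have "\<dots> = sorted_entry n u k * (b - p)"
    using assms(3) by simp
  finally show "induced_mean {a..b} n z u = b - sorted_entry n u k * (b - p)"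
    using assms(1,2) by (subst induced_mean_gap) auto
qed

text \<open>Gaps are nonnegative, so raising the levels from \<open>l\<close> to \<open>u\<close>
  can only lower the mean of each competitor \<open>z\<close>.\<close>

lemma sup_mean_le_induced_mean:
  assumes "a \<le> b" "x \<in> vecs n {a..b}" "u \<in> exceeding n l"
  shows "sup_mean {a..b} n (\<lambda>y. induced_mean {a..b} n y l) x u \<le> induced_mean {a..b} n x l"
  unfolding sup_mean_le_iff[OF assms(1,2)]
proof
  fix z assume "z \<in> sublevel_set {a..b} n (\<lambda>y. induced_mean {a..b} n y l) x"
  then have z: "z \<in> vecs n {a..b}" "induced_mean {a..b} n z l \<le> induced_mean {a..b} n x l"
    by (simp_all add: sublevel_set_def)
  have "(\<Sum>i=1..n. sorted_entry n l i * gap {a..b} n z i) \<le> (\<Sum>i=1..n. sorted_entry n u i * gap {a..b} n z i)"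
    using assms(3) gap_nonneg[OF z(1)] by (intro sum_mono mult_right_mono) (auto simp: exceeding_def)
  then show "induced_mean {a..b} n z u \<le> induced_mean {a..b} n x l"
    using z(2) unfolding induced_mean_gap[OF assms(1)] by simp
qed

text \<open>Strictness must survive the supremum. As levels are at most 1, the smallest margin
  \<theta> is also a multiplicative one, and it lowers every competitor's mean by an amount
  independent of \<open>z\<close>.\<close>

lemma sup_mean_less_induced_mean:
  assumes "a \<le> b" "x \<in> vecs n {a..b}" "l \<in> vecs n {0..1}" "n \<ge> 1"
    and less: "\<And>i. i \<in> {1..n} \<Longrightarrow> sorted_entry n l i < sorted_entry n u i"
    and "induced_mean {a..b} n x l < b"
  shows "sup_mean {a..b} n (\<lambda>y. induced_mean {a..b} n y l) x u < induced_mean {a..b} n x l"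
proof -
  define \<theta> where "\<theta> = Min ((\<lambda>i. sorted_entry n u i - sorted_entry n l i) ` {1..n})"
  have "\<theta> > 0"
    unfolding \<theta>_def using less assms(4) by (subst Min_gr_iff) auto
  have \<theta>_le: "\<theta> \<le> sorted_entry n u i - sorted_entry n l i" if "i \<in> {1..n}" for i
    unfolding \<theta>_def using that by (intro Min_le) auto
  have ge: "(1 + \<theta>) * sorted_entry n l i \<le> sorted_entry n u i" if "i \<in> {1..n}" for i
  proof -
    have "\<theta> * sorted_entry n l i \<le> \<theta> * 1"
      using sorted_entry_mem[OF assms(3) that] \<open>\<theta> > 0\<close> by (intro mult_left_mono) auto
    then show ?thesis
      using \<theta>_le[OF that] by (simp add: algebra_simps)
  qed
  let ?c = "b - induced_mean {a..b} n x l"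
  have "sup_mean {a..b} n (\<lambda>y. induced_mean {a..b} n y l) x u \<le> b - (1 + \<theta>) * ?c"
    unfolding sup_mean_le_iff[OF assms(1,2)]
  proof
    fix z assume "z \<in> sublevel_set {a..b} n (\<lambda>y. induced_mean {a..b} n y l) x"
    then have z: "z \<in> vecs n {a..b}" "induced_mean {a..b} n z l \<le> induced_mean {a..b} n x l"
      by (simp_all add: sublevel_set_def)
    have "(1 + \<theta>) * ?c \<le> (1 + \<theta>) * (b - induced_mean {a..b} n z l)"
      using z(2) \<open>\<theta> > 0\<close> by (intro mult_left_mono) auto
    also have "\<dots> = (\<Sum>i=1..n. (1 + \<theta>) * sorted_entry n l i * gap {a..b} n z i)"
      by (simp add: induced_mean_gap[OF assms(1)] sum_distrib_left mult.assoc)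
    also have "\<dots> \<le> (\<Sum>i=1..n. sorted_entry n u i * gap {a..b} n z i)"
      using ge gap_nonneg[OF z(1)] by (intro sum_mono mult_right_mono)
    finally show "induced_mean {a..b} n z u \<le> b - (1 + \<theta>) * ?c"
      by (simp add: induced_mean_gap[OF assms(1)])
  qed
  also have "\<dots> < induced_mean {a..b} n x l"
    using \<open>\<theta> > 0\<close> assms(6) by (simp add: algebra_simps)
  finally show ?thesis .
qed

text \<open>Nondecreasing endpoint vectors are their own order statistics, so coordinatewise bounds
  carry over to sorted entries.\<close>

lemma sorted_entry_box:
  assumes "u \<in> (\<Pi>\<^sub>E i\<in>{1..n}. {p i<..<q i})" "i \<in> {1..n}"
  shows "mono_on {1..n} p \<Longrightarrow> p i \<le> sorted_entry n u i"
    and "mono_on {1..n} q \<Longrightarrow> sorted_entry n u i \<le> q i"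
proof -
  have u: "p j \<le> u j" "u j \<le> q j" if "j \<in> {1..n}" for j
    using assms(1) that by (auto simp: PiE_iff less_imp_le)
  show "mono_on {1..n} p \<Longrightarrow> p i \<le> sorted_entry n u i"
    using sorted_entry_mono[where v = p and w = u, OF assms(2) u(1)] sorted_entry_of_mono_on[OF assms(2), of p] by simp
  show "mono_on {1..n} q \<Longrightarrow> sorted_entry n u i \<le> q i"
    using sorted_entry_mono[where v = u and w = q, OF assms(2) u(2)] sorted_entry_of_mono_on[OF assms(2), of q] by simp
qed

lemma sets_unif_sample_box: "(\<Pi>\<^sub>E i\<in>{1..n}. {p i<..<q i}) \<in> sets (unif_sample n)"
  by (intro sets_PiM_I_finite) auto

text \<open>Were the quantile \<open>y\<close> smaller than the mean, the event \<open>?S\<close> of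
  probability at least \<open>1 - \<alpha>\<close> would lie almost surely in
  \<open>exceeding n l\<close> and miss a box of positive probability inside it.\<close>

lemma upper_mean_bound_eq:
  fixes a b \<alpha> :: real and n :: nat and l x :: "nat \<Rightarrow> real"
  assumes "a < b" "n \<ge> 1" "0 < \<alpha>" "\<alpha> < 1" "l \<in> vecs n {0..1}" "x \<in> vecs n {a..b}"
    and P: "measure (unif_sample n) (exceeding n l) = 1 - \<alpha>"
    and le: "(b - induced_mean {a..b} n x l) / sorted_entry n l (first_positive_index n l) \<le> b - a"
  shows "upper_mean_bound \<alpha> {a..b} n (\<lambda>y. induced_mean {a..b} n y l) x = induced_mean {a..b} n x l"
proof -
  let ?T = "\<lambda>y. induced_mean {a..b} n y l"
  define k where "k = first_positive_index n l"
  define L where "L = sorted_entry n l k"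
  define c where "c = b - ?T x"
  have ab: "a \<le> b"
    using assms(1) by simp
  have k: "k \<in> {1..n}" "0 < L" "\<And>i. i \<in> {1..n} \<Longrightarrow> i < k \<Longrightarrow> sorted_entry n l i = 0"
    using first_positive_index[OF assms(5)] P assms(3) by (auto simp: k_def L_def)
  have lt1: "sorted_entry n l i < 1" if "i \<in> {1..n}" for i
    using level_lt_1[OF assms(5) _ that] P assms(4) by simp
  have "0 \<le> c"
    using induced_mean_le[OF ab assms(6,5)] by (simp add: c_def)
  have meas: "sup_mean {a..b} n ?T x \<in> borel_measurable (unif_sample n)"
    by (intro measurable_sup_mean ab assms) simp
  note q_le_iff = quantile_le_iff[OF unif_sample.prob_space_axioms meas, of "1 - \<alpha>",
      folded upper_mean_bound_def]
  show ?thesis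
  proof (rule antisym)
    have "1 - \<alpha> \<le> measure (unif_sample n) {u \<in> space (unif_sample n). sup_mean {a..b} n ?T x u \<le> ?T x}"
      unfolding P[symmetric] using sup_mean_le_induced_mean[OF ab assms(6)] meas
      by (intro unif_sample.finite_measure_mono) (auto simp: exceeding_def)
    then show "upper_mean_bound \<alpha> {a..b} n ?T x \<le> ?T x"
      using q_le_iff assms(3,4) by simp
  next
    show "?T x \<le> upper_mean_bound \<alpha> {a..b} n ?T x"
    proof (rule ccontr)
      define y where "y = upper_mean_bound \<alpha> {a..b} n ?T x"
      define \<delta> where "\<delta> = ?T x - y"
      assume "\<not> ?T x \<le> upper_mean_bound \<alpha> {a..b} n ?T x"
      then have "\<delta> > 0"
        by (simp add: \<delta>_def y_def)
      let ?S = "{u \<in> space (unif_sample n). sup_mean {a..b} n ?T x u \<le> y}"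
      have S: "?S \<in> sets (unif_sample n)"
        using meas by simp
      have PS: "1 - \<alpha> \<le> measure (unif_sample n) ?S"
        using q_le_iff[of y] assms(3,4) by (simp add: y_def)
      \<comment> \<open>Test with the single gap \<open>c / sorted_entry n l i\<close>. It meets the
        sublevel constraint with equality, and \<open>le\<close> makes it fit into
        \<open>{a..b}\<close>.\<close>
      have S_ge: "(c + \<delta>) * sorted_entry n l i \<le> sorted_entry n u i * c"
        if u: "u \<in> ?S" and i: "i \<in> {1..n}" "k \<le> i" for u i
      proof -
        have L_le: "L \<le> sorted_entry n l i"
          unfolding L_def using sorted_entry_mono_index[OF k(1) i] .
        then have "c / sorted_entry n l i \<le> c / L"
          using k(2) \<open>0 \<le> c\<close> by (intro divide_left_mono) auto
        also have "\<dots> \<le> b - a"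
          using le by (simp add: c_def L_def k_def)
        finally have p: "a \<le> b - c / sorted_entry n l i" "b - c / sorted_entry n l i \<le> b"
          using \<open>0 \<le> c\<close> L_le k(2) by simp_all
        define z where "z = (\<lambda>j\<in>{1..n}. if j \<le> i then b - c / sorted_entry n l i else b)"
        note z = induced_mean_two_step[OF p i(1), folded z_def]
        have "z \<in> sublevel_set {a..b} n ?T x"
          using z(1) z(2)[of l] L_le k(2) by (simp add: sublevel_set_def c_def)
        then have "induced_mean {a..b} n z u \<le> y"
          using u sup_mean_le_iff[OF ab assms(6)] by blast
        then have "c + \<delta> \<le> sorted_entry n u i * c / sorted_entry n l i"
          by (simp add: z(2) c_def \<delta>_def)
        then show ?thesis
          using L_le k(2) by (simp add: pos_le_divide_eq)
      qed
      \<comment> \<open>An upper bound for the \<open>k\<close>-th order statistic that leaves room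
        above \<open>L\<close> yet violates \<open>S_ge\<close> at \<open>k\<close>. For
        \<open>c = 0\<close> any number between \<open>L\<close> and 1 serves.\<close>
      obtain r where r: "L < r" "r < 1" "r * c < (c + \<delta>) * L"
      proof (cases "c = 0")
        case True
        then show ?thesis
          using that[of "(L + 1) / 2"] lt1[OF k(1)] k(2) \<open>\<delta> > 0\<close> by (simp add: L_def)
      next
        case False
        then have "L < (c + \<delta>) * L / c"
          using \<open>0 \<le> c\<close> \<open>\<delta> > 0\<close> k(2) by (simp add: field_simps)
        then obtain r where "L < r" "r < min 1 ((c + \<delta>) * L / c)"
          using dense[of L "min 1 ((c + \<delta>) * L / c)"] lt1[OF k(1)] by (auto simp: L_def)
        then show ?thesis
          using that[of r] False \<open>0 \<le> c\<close> by (simp add: pos_less_divide_eq)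
      qed
      \<comment> \<open>The first \<open>k\<close> coordinates lie just above \<open>L\<close>, the
        later ones above every level, which puts the box inside
        \<open>exceeding n l\<close>.\<close>
      define p where "p i = (if i \<le> k then L else sorted_entry n l n)" for i
      define q where "q i = (if i \<le> k then r else 1)" for i
      let ?B = "\<Pi>\<^sub>E i\<in>{1..n}. {p i<..<q i}"
      have Ln: "sorted_entry n l i \<le> sorted_entry n l n" if "i \<in> {1..n}" for i
        using that by (intro sorted_entry_mono_index) auto
      have mono: "mono_on {1..n} p" "mono_on {1..n} q"
        using Ln[OF k(1)] r(2) by (auto simp: mono_on_def p_def q_def L_def)
      have "0 \<le> p i \<and> p i < q i \<and> q i \<le> 1" if "i \<in> {1..n}" for i
        using Ln[OF k(1)] k(2) r lt1[of n] assms(2) by (auto simp: p_def q_def L_def)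
      then have B_pos: "measure (unif_sample n) ?B > 0"
        by (rule measure_unif_sample_box_pos)
      have l_le_p: "sorted_entry n l i \<le> p i" if "i \<in> {1..n}" for i
        using Ln[OF that] sorted_entry_mono_index[OF that k(1)] by (auto simp: p_def L_def)
      have B_exc: "?B \<subseteq> exceeding n l"
      proof
        fix u assume u: "u \<in> ?B"
        have "sorted_entry n l i \<le> sorted_entry n u i" if "i \<in> {1..n}" for i
          using sorted_entry_box(1)[OF u that mono(1)] l_le_p[OF that] by simp
        then show "u \<in> exceeding n l"
          using sets.sets_into_space[OF sets_unif_sample_box] u unfolding exceeding_def by blast
      qed
      have B_S: "?B \<inter> ?S = {}"
      proof -
        have False if "u \<in> ?B" "u \<in> ?S" for u
        proof -
          have "sorted_entry n u k * c \<le> r * c"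
            using sorted_entry_box(2)[OF that(1) k(1) mono(2)] \<open>0 \<le> c\<close>
            by (intro mult_right_mono) (auto simp: q_def)
          then show False
            using S_ge[OF that(2) k(1)] r(3) by (simp add: L_def)
        qed
        then show ?thesis
          by blast
      qed
      \<comment> \<open>Below \<open>k\<close> the levels are 0 and almost sure positivity of the
        sample suffices; from \<open>k\<close> on, \<open>S_ge\<close> with \<delta> > 0 forces the
        inequality.\<close>
      have S_exc: "AE u in unif_sample n. u \<in> ?S \<union> ?B \<longrightarrow> u \<in> exceeding n l"
        using AE_unif_sample_Ioo
      proof eventually_elim
        case (elim u)
        have "u \<in> exceeding n l" if u: "u \<in> ?S"
        proof -
          have "sorted_entry n l i \<le> sorted_entry n u i" if i: "i \<in> {1..n}" for i
          proof (cases "i < k")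
            case True
            then show ?thesis
              using k(3)[OF i] sorted_entry_mem[OF elim i] by simp
          next
            case False
            then have "0 < sorted_entry n l i"
              using k(2) sorted_entry_mono_index[OF k(1) i, of l] unfolding L_def by linarith
            moreover have ge: "(c + \<delta>) * sorted_entry n l i \<le> sorted_entry n u i * c"
              using S_ge[OF u i] False by simp
            ultimately have "sorted_entry n l i * c < sorted_entry n u i * c"
              using mult_pos_pos[OF \<open>\<delta> > 0\<close>, of "sorted_entry n l i"]
              unfolding distrib_right mult.commute[of c] by linarith
            then show ?thesis
              using \<open>0 \<le> c\<close> by (simp add: mult_less_cancel_right)
          qed
          then show ?thesis
            using u by (simp add: exceeding_def)
        qed
        then show ?case
          using B_exc by blast
      qed
      have "measure (unif_sample n) ?S + measure (unif_sample n) ?B = measure (unif_sample n) (?S \<union> ?B)"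
        using S sets_unif_sample_box B_S
        by (intro unif_sample.finite_measure_Union[symmetric]) auto
      also have "\<dots> \<le> measure (unif_sample n) (exceeding n l)"
        by (rule unif_sample.finite_measure_mono_AE[OF S_exc sets_exceeding])
      finally show False
        using PS B_pos P by simp
    qed
  qed
qed

text \<open>The event of a strictly smaller supremum contains almost all of
  \<open>exceeding n l\<close> and also a disjoint box of positive probability, so it exceeds
  \<open>1 - \<alpha>\<close>.\<close>

lemma upper_mean_bound_less:
  fixes a b \<alpha> :: real and n :: nat and l x :: "nat \<Rightarrow> real"
  assumes "a < b" "n \<ge> 1" "0 < \<alpha>" "\<alpha> < 1" "l \<in> vecs n {0..1}" "x \<in> vecs n {a..b}"
    and P: "measure (unif_sample n) (exceeding n l) = 1 - \<alpha>"
    and gt: "(b - induced_mean {a..b} n x l) / sorted_entry n l (first_positive_index n l) > b - a"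
  shows "upper_mean_bound \<alpha> {a..b} n (\<lambda>y. induced_mean {a..b} n y l) x < induced_mean {a..b} n x l"
proof -
  let ?T = "\<lambda>y. induced_mean {a..b} n y l"
  define k where "k = first_positive_index n l"
  define L where "L = sorted_entry n l k"
  define c where "c = b - ?T x"
  define Ln where "Ln = sorted_entry n l n"
  have ab: "a \<le> b"
    using assms(1) by simp
  have k: "k \<in> {1..n}" "0 < L" "\<And>i. i \<in> {1..n} \<Longrightarrow> i < k \<Longrightarrow> sorted_entry n l i = 0"
    using first_positive_index[OF assms(5)] P assms(3) by (auto simp: k_def L_def)
  have lt1: "sorted_entry n l i < 1" if "i \<in> {1..n}" for i
    using level_lt_1[OF assms(5) _ that] P assms(4) by simp
  have le_Ln: "sorted_entry n l i \<le> Ln" if "i \<in> {1..n}" for i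
    unfolding Ln_def using that by (intro sorted_entry_mono_index) auto
  have meas: "sup_mean {a..b} n ?T x \<in> borel_measurable (unif_sample n)"
    by (intro measurable_sup_mean ab assms) simp
  \<comment> \<open>\<open>g\<close> is the part of the constraint that a gap at \<open>k\<close>
    cannot supply even at full length; \<kappa> is half the room above the largest level.\<close>
  define g where "g = c - L * (b - a)"
  define \<kappa> where "\<kappa> = (1 - Ln) / 2"
  have "g > 0"
    using gt k(2) by (simp add: g_def c_def L_def k_def pos_less_divide_eq mult.commute)
  have "\<kappa> > 0"
    using lt1[of n] assms(2) by (simp add: \<kappa>_def Ln_def)
  have "c > 0"
    using \<open>g > 0\<close> k(2) assms(1) mult_pos_pos[of L "b - a"] unfolding g_def by linarith
  \<comment> \<open>\<eta> is the allowed drop of the \<open>k\<close>-th order statistic below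
    \<open>L\<close>. The first bound keeps the box positive, the second makes the loss at most half
    of the gain \<kappa> * g.\<close>
  define \<eta> where "\<eta> = min (L / 2) (\<kappa> * g / 2 / (b - a))"
  have \<eta>: "0 < \<eta>" "\<eta> < L" "\<eta> * (b - a) \<le> \<kappa> * g / 2"
  proof -
    show "0 < \<eta>" "\<eta> < L"
      using k(2) \<open>g > 0\<close> \<open>\<kappa> > 0\<close> assms(1) by (auto simp: \<eta>_def)
    have "\<eta> * (b - a) \<le> \<kappa> * g / 2 / (b - a) * (b - a)"
      using assms(1) by (intro mult_right_mono) (auto simp: \<eta>_def)
    also have "\<dots> = \<kappa> * g / 2"
      by (rule nonzero_eq_divide_eq[THEN iffD1, OF _ refl]) (use assms(1) in simp)
    finally show "\<eta> * (b - a) \<le> \<kappa> * g / 2" .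
  qed
  define p where "p i = (if i \<le> k then L - \<eta> else Ln + \<kappa>)" for i
  define q where "q i = (if i \<le> k then L - \<eta> / 2 else 1)" for i
  let ?B = "\<Pi>\<^sub>E i\<in>{1..n}. {p i<..<q i}"
  let ?S = "{u \<in> space (unif_sample n). sup_mean {a..b} n ?T x u < ?T x}"
  have S: "?S \<in> sets (unif_sample n)"
    using meas by simp
  have L_Ln: "L \<le> Ln" "Ln < 1"
    using le_Ln[OF k(1)] lt1[of n] assms(2) by (simp_all add: L_def Ln_def)
  have mono: "mono_on {1..n} p" "mono_on {1..n} q"
    using L_Ln \<eta> \<open>\<kappa> > 0\<close> by (auto simp: mono_on_def p_def q_def)
  have "0 \<le> p i \<and> p i < q i \<and> q i \<le> 1" for i
    using L_Ln \<eta> k(2) \<open>\<kappa> > 0\<close> by (auto simp: p_def q_def \<kappa>_def field_simps)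
  then have B_pos: "measure (unif_sample n) ?B > 0"
    by (intro measure_unif_sample_box_pos)
  have B_exc: "?B \<inter> exceeding n l = {}"
  proof -
    have "u \<notin> exceeding n l" if "u \<in> ?B" for u
    proof
      assume "u \<in> exceeding n l"
      then have "L \<le> sorted_entry n u k"
        using k(1) by (simp add: exceeding_def L_def)
      also have "\<dots> \<le> L - \<eta> / 2"
        using sorted_entry_box(2)[OF that k(1) mono(2)] by (simp add: q_def)
      finally show False
        using \<eta>(1) by simp
    qed
    then show ?thesis
      by blast
  qed
  have B_S: "u \<in> ?S" if u: "u \<in> ?B" for u
  proof -
    have "sup_mean {a..b} n ?T x u \<le> b - (c + \<kappa> * g / 2)"
      unfolding sup_mean_le_iff[OF ab assms(6)]
    proof
      fix z assume "z \<in> sublevel_set {a..b} n ?T x"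
      then have z: "z \<in> vecs n {a..b}" "?T z \<le> ?T x"
        by (simp_all add: sublevel_set_def)
      let ?d = "gap {a..b} n z"
      note d = gap_nonneg[OF z(1)] gap_le[OF z(1)]
      have c_le: "c \<le> (\<Sum>i=1..n. sorted_entry n l i * ?d i)"
        using z(2) by (simp add: c_def induced_mean_gap[OF ab])
      \<comment> \<open>Levels before \<open>k\<close> vanish, the \<open>k\<close>-th gap is at
        most \<open>b - a\<close> and later levels are below 1, so the gaps after \<open>k\<close>
        sum to at least \<open>g\<close>.\<close>
      have "g \<le> (\<Sum>i=1..n. sorted_entry n l i * ?d i) - L * ?d k"
        using c_le mult_left_mono[OF d(2)[OF k(1)] less_imp_le[OF k(2)]] unfolding g_def by linarith
      also have "\<dots> = (\<Sum>i=1..n. sorted_entry n l i * ?d i - (if i = k then L * ?d i else 0))"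
        using k(1) by (simp add: sum_subtractf)
      also have "\<dots> \<le> (\<Sum>i=1..n. if k < i then ?d i else 0)"
      proof (intro sum_mono)
        fix i assume i: "i \<in> {1..n}"
        show "sorted_entry n l i * ?d i - (if i = k then L * ?d i else 0) \<le> (if k < i then ?d i else 0)"
          using k(3)[OF i] d(1)[OF i] lt1[OF i] mult_right_mono[of "sorted_entry n l i" 1 "?d i"]
          by (cases i k rule: linorder_cases) (auto simp: L_def)
      qed
      finally have g_le: "\<kappa> * g \<le> \<kappa> * (\<Sum>i=1..n. if k < i then ?d i else 0)"
        using \<open>\<kappa> > 0\<close> by simp
      \<comment> \<open>Passing from \<open>l\<close> to \<open>u\<close> costs at most \<eta> times
        the \<open>k\<close>-th gap and gains at least \<kappa> times each later gap.\<close>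
      have "c + \<kappa> * g / 2 \<le> c - \<eta> * (b - a) + \<kappa> * g"
        using \<eta>(3) by simp
      also have "\<dots> \<le> (\<Sum>i=1..n. sorted_entry n l i * ?d i) - \<eta> * ?d k +
          \<kappa> * (\<Sum>i=1..n. if k < i then ?d i else 0)"
        using c_le g_le mult_left_mono[OF d(2)[OF k(1)] less_imp_le[OF \<eta>(1)]] by linarith
      also have "\<dots> = (\<Sum>i=1..n. sorted_entry n l i * ?d i - (if i = k then \<eta> * ?d i else 0) +
          (if k < i then \<kappa> * ?d i else 0))"
        using k(1) by (simp add: sum_subtractf sum.distrib sum_distrib_left if_distrib[of "(*) \<kappa>"] cong: if_cong)
      also have "\<dots> \<le> (\<Sum>i=1..n. sorted_entry n u i * ?d i)"
      proof (intro sum_mono)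
        fix i assume i: "i \<in> {1..n}"
        have u_ge: "p i \<le> sorted_entry n u i"
          using sorted_entry_box(1)[OF u i mono(1)] .
        have "sorted_entry n l i - (if i = k then \<eta> else 0) + (if k < i then \<kappa> else 0) \<le> p i"
          using k(3)[OF i] le_Ln[OF i] \<eta>(2)
          by (cases i k rule: linorder_cases) (auto simp: p_def L_def)
        then have "(sorted_entry n l i - (if i = k then \<eta> else 0) + (if k < i then \<kappa> else 0)) * ?d i
            \<le> sorted_entry n u i * ?d i"
          using u_ge d(1)[OF i] by (intro mult_right_mono) auto
        then show "sorted_entry n l i * ?d i - (if i = k then \<eta> * ?d i else 0) +
            (if k < i then \<kappa> * ?d i else 0) \<le> sorted_entry n u i * ?d i"
          by (simp add: algebra_simps split: if_splits)
      qed
      finally show "induced_mean {a..b} n z u \<le> b - (c + \<kappa> * g / 2)"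
        by (simp add: induced_mean_gap[OF ab])
    qed
    also have "\<dots> < ?T x"
      using \<open>\<kappa> > 0\<close> \<open>g > 0\<close> by (simp add: c_def)
    finally show ?thesis
      using sets.sets_into_space[OF sets_unif_sample_box] u by blast
  qed
  \<comment> \<open>Excluding equality with a level makes the domination on
    \<open>exceeding n l\<close> strict, as \<open>sup_mean_less_induced_mean\<close> needs.\<close>
  have "AE u in unif_sample n. \<forall>i\<in>{1..n}. sorted_entry n u i \<noteq> sorted_entry n l i"
    by (intro AE_finite_allI AE_unif_sample_sorted_neq) auto
  then have "AE u in unif_sample n. u \<in> exceeding n l \<union> ?B \<longrightarrow> u \<in> ?S"
  proof eventually_elim
    case (elim u)
    have "u \<in> ?S" if u: "u \<in> exceeding n l"
    proof -
      have "sorted_entry n l i < sorted_entry n u i" if "i \<in> {1..n}" for i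
        using u elim that by (force simp: exceeding_def less_le)
      then have "sup_mean {a..b} n ?T x u < ?T x"
        using \<open>c > 0\<close> by (intro sup_mean_less_induced_mean ab assms) (auto simp: c_def)
      then show ?thesis
        using u by (simp add: exceeding_def)
    qed
    then show ?case
      using B_S by blast
  qed
  then have "measure (unif_sample n) (exceeding n l \<union> ?B) \<le> measure (unif_sample n) ?S"
    using S by (rule unif_sample.finite_measure_mono_AE)
  moreover have "measure (unif_sample n) (exceeding n l \<union> ?B) =
      measure (unif_sample n) (exceeding n l) + measure (unif_sample n) ?B"
    using B_exc sets_unif_sample_box sets_exceeding
    by (intro unif_sample.finite_measure_Union) auto
  ultimately have "1 - \<alpha> < measure (unif_sample n) ?S"
    using B_pos P by simp
  then show ?thesis
    unfolding upper_mean_bound_def using assms(3,4)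
    by (intro quantile_less unif_sample.prob_space_axioms meas) auto
qed

theorem theoremE6:
  fixes a b \<alpha> :: real and D :: "real set" and n i0 :: nat
    and l :: "nat \<Rightarrow> real" and T :: "(nat \<Rightarrow> real) \<Rightarrow> real"
  assumes "a < b" and "D \<subseteq> {a..b}" and "n \<ge> 1" and "0 < \<alpha>" and "\<alpha> < 1"
    and "l \<in> vecs n {0..1}"
    and "exact_lower_confidence_bound {a..b} n \<alpha> (\<lambda>X. step_bound {a..b} n X l)"
    and "i0 = first_positive_index n l"
    and "T = (\<lambda>y. induced_mean {a..b} n y l)"
  shows "\<forall>x \<in> vecs n D.
    (a \<le> b - (b - induced_mean {a..b} n x l) / sorted_entry n l i0 \<longrightarrow>
      upper_mean_bound \<alpha> {a..b} n T x = induced_mean {a..b} n x l) \<and>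
    (a > b - (b - induced_mean {a..b} n x l) / sorted_entry n l i0 \<and> n > i0 \<longrightarrow>
      upper_mean_bound \<alpha> {a..b} n T x < induced_mean {a..b} n x l) \<and>
    ((\<forall>i \<in> {1..n}. x i < b - (b - a) * sorted_entry n l i0 / sorted_entry n l n) \<and> n > i0 \<longrightarrow>
      upper_mean_bound \<alpha> {a..b} n T x < induced_mean {a..b} n x l)"
proof
  fix x assume "x \<in> vecs n D"
  with assms(2) have x: "x \<in> vecs n {a..b}"
    by (auto simp: PiE_iff)
  have P: "measure (unif_sample n) (exceeding n l) = 1 - \<alpha>"
    using measure_exceeding[OF assms(3,1,5,6,7)] .
  define L where "L = sorted_entry n l i0"
  have i0: "i0 \<in> {1..n}" "0 < L"
    using first_positive_index[OF assms(6)] P assms(4,8) by (simp_all add: L_def)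
  let ?m = "induced_mean {a..b} n x l"
  have eq: "upper_mean_bound \<alpha> {a..b} n T x = ?m" if "a \<le> b - (b - ?m) / L"
    using upper_mean_bound_eq[OF assms(1,3,4,5,6) x P] that by (simp add: L_def assms(8,9))
  have less: "upper_mean_bound \<alpha> {a..b} n T x < ?m" if "a > b - (b - ?m) / L"
    using upper_mean_bound_less[OF assms(1,3,4,5,6) x P] that by (simp add: L_def assms(8,9))
  \<comment> \<open>Among the terms of \<open>b - ?m\<close>, the last one alone, the largest level
    times \<open>b\<close> minus the largest entry, already exceeds
    \<open>(b - a) * L\<close>.\<close>
  have "a > b - (b - ?m) / L"
    if small: "\<forall>i \<in> {1..n}. x i < b - (b - a) * L / sorted_entry n l n"
  proof -
    have n: "n \<in> {1..n}"
      using assms(3) by simp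
    have Ln: "0 < sorted_entry n l n"
      using i0 sorted_entry_mono_index[OF i0(1) n, of l] by (simp add: L_def)
    have "sorted_entry n x n < b - (b - a) * L / sorted_entry n l n"
      using small sorted_entry_in_image[OF n, of x] by auto
    then have "(b - a) * L < sorted_entry n l n * (b - sorted_entry n x n)"
      using Ln by (simp add: field_simps)
    also have "\<dots> = sorted_entry n l n * gap {a..b} n x n"
      using sum_gap[OF less_imp_le[OF assms(1)] n, of x] by simp
    also have "\<dots> \<le> (\<Sum>i=1..n. sorted_entry n l i * gap {a..b} n x i)"
      using n gap_nonneg[OF x] sorted_entry_mem[OF assms(6)]
      by (intro member_le_sum[of n "{1..n}" "\<lambda>i. sorted_entry n l i * gap {a..b} n x i"]) auto
    also have "\<dots> = b - ?m"
      using induced_mean_gap[of a b n x l] assms(1) by simp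
    finally show ?thesis
      using i0(2) by (simp add: field_simps)
  qed
  with eq less show "(a \<le> b - (b - ?m) / sorted_entry n l i0 \<longrightarrow>
      upper_mean_bound \<alpha> {a..b} n T x = ?m) \<and>
    (a > b - (b - ?m) / sorted_entry n l i0 \<and> n > i0 \<longrightarrow> upper_mean_bound \<alpha> {a..b} n T x < ?m) \<and>
    ((\<forall>i \<in> {1..n}. x i < b - (b - a) * sorted_entry n l i0 / sorted_entry n l n) \<and> n > i0 \<longrightarrow>
      upper_mean_bound \<alpha> {a..b} n T x < ?m)"
    unfolding L_def by blast
qed

end
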